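(* Let $X\neq\{0\}$ be a real Hilbert space and let $e\in X$ satisfy $\|e\|=1$. Then the maximally monotone operator $A_e\colon X\rightrightarrows X$ is given by $$(\forall x\in X)\quad A_e x=\begin{cases} x-\dfrac{\|x\|^2}{\langle e,x\rangle}\, e, & \text{if } \langle e,x\rangle>0;\\[2mm] \mathbb{R}_-\cdot e, & \text{if } x=0;\\ \varnothing, & \text{otherwise.}\end{cases}$$
   Context: For $e$ in a real Hilbert space $X\ne\{0\}$ with $\|e\|\le 1$, define $R_e\colon X\to X\colon x\mapsto \|x\|\,e$ and $T_e\colon X\to X\colon x\mapsto \tfrac12 x+\tfrac12 R_e x=\tfrac12x+\tfrac12\|x\|e$. The map $R_e$ is nonexpansive, so $T_e$ is firmly nonexpansive and is the resolvent $J_{A_e}=(\mathrm{Id}+A_e)^{-1}$ of the maximally monotone set-valued operator $A_e=T_e^{-1}-\mathrm{Id}$ (inverse in the sense of set-valued operators); equivalently, the graph of $A_e$ is $\{(T_ey,\,y-T_ey) : y\in X\}$. Here $\mathbb{R}_-=\{t\in\mathbb{R}: t\le 0\}$ and $\mathbb{R}_-\cdot e=\{te: t\le 0\}$. In the first case the displayed vector stands for the singleton containing it. *)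

theory Defs
  imports "HOL-Analysis.Analysis"
begin

text \<open>A set-valued operator on \<open>X\<close> is a function \<open>'a \<Rightarrow> 'a set\<close>; a point-valued map \<open>f\<close> is
  identified with \<open>\<lambda>x. {f x}\<close>.\<close>

definition op_inverse :: "('a \<Rightarrow> 'a set) \<Rightarrow> 'a \<Rightarrow> 'a set" where
  "op_inverse A = (\<lambda>u. {x. u \<in> A x})"

definition op_diff :: "('a::minus \<Rightarrow> 'a set) \<Rightarrow> ('a \<Rightarrow> 'a set) \<Rightarrow> 'a \<Rightarrow> 'a set" where
  "op_diff A B = (\<lambda>x. {u - v |u v. u \<in> A x \<and> v \<in> B x})"

definition monotone_op :: "('a::real_inner \<Rightarrow> 'a set) \<Rightarrow> bool" where
  "monotone_op A \<longleftrightarrow> (\<forall>x y. \<forall>u\<in>A x. \<forall>v\<in>A y. 0 \<le> inner (x - y) (u - v))"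

text \<open>The pointwise inclusion \<open>A x \<subseteq> B x\<close> says that the graph of \<open>B\<close> extends the graph of \<open>A\<close>.\<close>

definition maximally_monotone :: "('a::real_inner \<Rightarrow> 'a set) \<Rightarrow> bool" where
  "maximally_monotone A \<longleftrightarrow>
     monotone_op A \<and> (\<forall>B. monotone_op B \<and> (\<forall>x. A x \<subseteq> B x) \<longrightarrow> B = A)"

definition R_map :: "'a::real_inner \<Rightarrow> 'a \<Rightarrow> 'a" where
  "R_map e x = norm x *\<^sub>R e"

definition T_map :: "'a::real_inner \<Rightarrow> 'a \<Rightarrow> 'a" where
  "T_map e x = (1/2) *\<^sub>R x + (1/2) *\<^sub>R R_map e x"

definition A_op :: "'a::real_inner \<Rightarrow> 'a \<Rightarrow> 'a set" where
  "A_op e = op_diff (op_inverse (\<lambda>x. {T_map e x})) (\<lambda>x. {x})"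

end

theory Submission
  imports Defs
begin

text \<open>
  The points of \<open>A_op e x\<close> are the differences \<open>y - x\<close> with \<open>T_map e y = x\<close>. Monotonicity is
  nonexpansiveness of the map \<open>R_map e\<close> in disguise: since \<open>T_map e y\<close> and \<open>y - T_map e y\<close> are
  the half sum and the half difference of \<open>y\<close> and \<open>R_map e y\<close>, the inner product in the definition
  of monotonicity is a quarter of a difference of two squared norms (\<open>monotone_A_op\<close>). Maximality is the elementary half of Minty's theorem, as every \<open>y\<close> lies in the
  range of \<open>Id + A_op e\<close>, being reached at \<open>T_map e y\<close>
  (\<open>maximally_monotone_if_range_UNIV\<close>).

  For the formula, put \<open>r = norm y\<close>. The equation \<open>T_map e y = x\<close> then reads
  \<open>y = 2 *\<^sub>R x - r *\<^sub>R e\<close>. The only remaining constraint is that this vector does have norm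
  \<open>r\<close>; after squaring, the terms \<open>r\<^sup>2\<close> cancel because \<open>norm e = 1\<close>, and what is left is the
  equation \<open>(norm x)\<^sup>2 = r * inner e x\<close>, linear in \<open>r \<ge> 0\<close> (\<open>A_op_parametrization\<close>). It has exactly
  one solution if \<open>inner e x > 0\<close>, every \<open>r \<ge> 0\<close> solves it if \<open>x = 0\<close>, and otherwise there is none
  because the left-hand side is positive while the right-hand side is not.
\<close>

lemma mem_A_op_iff: "u \<in> A_op e x \<longleftrightarrow> T_map e (x + u) = x"
  unfolding A_op_def op_diff_def op_inverse_def
  by (auto simp: algebra_simps)

text \<open>
  The elementary half of Minty's theorem. If \<open>u \<in> B x\<close> for a monotone extension \<open>B\<close> of \<open>A\<close>, choose
  \<open>z\<close> with \<open>(x + u) - z \<in> A z\<close>. Both points lie in the graph of \<open>B\<close> and the two value differences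
  are opposite, \<open>u - ((x + u) - z) = - (x - z)\<close>, so monotonicity forces \<open>x = z\<close>.
\<close>

lemma maximally_monotone_if_range_UNIV:
  fixes A :: "'a::real_inner \<Rightarrow> 'a set"
  assumes mono: "monotone_op A" and range: "\<And>y. \<exists>z. y - z \<in> A z"
  shows "maximally_monotone A"
  unfolding maximally_monotone_def
proof (intro conjI allI impI mono ext)
  fix B :: "'a \<Rightarrow> 'a set" and x
  assume B: "monotone_op B \<and> (\<forall>x. A x \<subseteq> B x)"
  have "u \<in> A x" if "u \<in> B x" for u
  proof -
    obtain z where z: "(x + u) - z \<in> A z"
      using range by blast
    then have "0 \<le> inner (x - z) (u - ((x + u) - z))"
      using B that unfolding monotone_op_def by blast
    also have "u - ((x + u) - z) = - (x - z)"
      by simp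
    finally have "x = z"
      by (simp only: inner_minus_right) (metis eq_iff_diff_eq_0 inner_gt_zero_iff neg_0_le_iff_le not_le)
    with z show ?thesis
      by simp
  qed
  with B show "B x = A x"
    by blast
qed

lemma norm_R_map_diff_le:
  assumes "norm e \<le> 1"
  shows "norm (R_map e x - R_map e y) \<le> norm (x - y)"
proof -
  have "norm (R_map e x - R_map e y) = \<bar>norm x - norm y\<bar> * norm e"
    by (simp add: R_map_def flip: scaleR_diff_left)
  also have "\<dots> \<le> \<bar>norm x - norm y\<bar>"
    using assms by (simp add: mult_left_le)
  also have "\<dots> \<le> norm (x - y)"
    by (rule norm_triangle_ineq3)
  finally show ?thesis .
qed

lemma monotone_A_op:
  assumes "norm e \<le> 1"
  shows "monotone_op (A_op e)"
  unfolding monotone_op_def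
proof (intro allI ballI)
  fix x y u v
  assume "u \<in> A_op e x" "v \<in> A_op e y"
  then have x: "x + x = (x + u) + R_map e (x + u)" and y: "y + y = (y + v) + R_map e (y + v)"
    unfolding mem_A_op_iff T_map_def
    by (metis scaleR_half_double scaleR_right_distrib)+
  define p where "p = (x + u) - (y + v)"
  define q where "q = R_map e (x + u) - R_map e (y + v)"
  have "R_map e (x + u) = x - u" "R_map e (y + v) = y - v"
    using x y by (simp_all add: algebra_simps)
  then have q: "q = (x - u) - (y - v)"
    by (simp add: q_def)
  have "4 * inner (x - y) (u - v) = (norm p)\<^sup>2 - (norm q)\<^sup>2"
    unfolding p_def q by (simp add: power2_norm_eq_inner algebra_simps inner_commute)
  moreover have "(norm q)\<^sup>2 \<le> (norm p)\<^sup>2"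
    using norm_R_map_diff_le[OF assms] by (simp add: p_def q_def power_mono)
  ultimately show "0 \<le> inner (x - y) (u - v)"
    by linarith
qed

lemma maximally_monotone_A_op:
  assumes "norm e \<le> 1"
  shows "maximally_monotone (A_op e)"
proof (rule maximally_monotone_if_range_UNIV[OF monotone_A_op[OF assms]])
  show "\<exists>z. y - z \<in> A_op e z" for y
    by (rule exI[of _ "T_map e y"]) (simp add: mem_A_op_iff)
qed

text \<open>
  Here \<open>r\<close> is the norm of the preimage \<open>y = x + u\<close> of \<open>x\<close> under \<open>T_map e\<close>. That norm is
  consistent with \<open>y = 2 *\<^sub>R x - r *\<^sub>R e\<close> exactly when the linear equation for \<open>r\<close> holds.
\<close>

lemma A_op_parametrization:
  assumes e: "norm e = 1"
  shows "A_op e x = {x - r *\<^sub>R e |r. 0 \<le> r \<and> (norm x)\<^sup>2 = r * inner e x}"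
proof -
  have consistent: "norm (x + (x - r *\<^sub>R e)) = r \<longleftrightarrow> (norm x)\<^sup>2 = r * inner e x"
    if "0 \<le> r" for r
  proof -
    have "(norm (x + (x - r *\<^sub>R e)))\<^sup>2 = r\<^sup>2 + 4 * ((norm x)\<^sup>2 - r * inner e x)"
      using e unfolding power2_norm_eq_inner norm_eq_1
      by (simp add: algebra_simps inner_commute power2_eq_square)
    moreover have "norm (x + (x - r *\<^sub>R e)) = r \<longleftrightarrow> (norm (x + (x - r *\<^sub>R e)))\<^sup>2 = r\<^sup>2"
      using that by (simp add: power2_eq_iff_nonneg)
    ultimately show ?thesis
      by simp
  qed
  have preimage: "u \<in> A_op e x \<longleftrightarrow> u = x - norm (x + u) *\<^sub>R e" for u
  proof -
    have "u \<in> A_op e x \<longleftrightarrow> 2 *\<^sub>R T_map e (x + u) = 2 *\<^sub>R x"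
      by (simp add: mem_A_op_iff)
    also have "2 *\<^sub>R T_map e (x + u) = (x + u) + norm (x + u) *\<^sub>R e"
      by (simp add: T_map_def R_map_def scaleR_right_distrib)
    also have "\<dots> = 2 *\<^sub>R x \<longleftrightarrow> u = x - norm (x + u) *\<^sub>R e"
      by (auto simp: scaleR_2 algebra_simps)
    finally show ?thesis .
  qed
  show ?thesis
  proof (intro set_eqI iffI)
    fix u
    assume "u \<in> A_op e x"
    then have u: "u = x - norm (x + u) *\<^sub>R e"
      by (simp only: preimage)
    then have "norm (x + (x - norm (x + u) *\<^sub>R e)) = norm (x + u)"
      by simp
    then have "(norm x)\<^sup>2 = norm (x + u) * inner e x"
      by (simp only: consistent[OF norm_ge_zero])
    with u show "u \<in> {x - r *\<^sub>R e |r. 0 \<le> r \<and> (norm x)\<^sup>2 = r * inner e x}"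
      using norm_ge_zero by blast
  next
    fix u
    assume "u \<in> {x - r *\<^sub>R e |r. 0 \<le> r \<and> (norm x)\<^sup>2 = r * inner e x}"
    then obtain r where "u = x - r *\<^sub>R e" "norm (x + u) = r"
      using consistent by blast
    then show "u \<in> A_op e x"
      by (simp only: preimage)
  qed
qed

theorem theorem2p2:
  fixes e :: "'a :: {real_inner, complete_space}"
  assumes "(UNIV :: 'a set) \<noteq> {0}"
    and "norm e = 1"
  shows "maximally_monotone (A_op e) \<and>
    (\<forall>x. A_op e x =
      (if inner e x > 0 then {x - ((norm x)\<^sup>2 / inner e x) *\<^sub>R e}
       else if x = 0 then {t *\<^sub>R e |t::real. t \<le> 0}
       else {}))"
proof (intro conjI allI)
  show "maximally_monotone (A_op e)"
    using assms(2) by (simp add: maximally_monotone_A_op)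
next
  fix x :: 'a
  note A = A_op_parametrization[OF assms(2), of x]
  consider (pos) "inner e x > 0" | (zero) "x = 0" | (other) "inner e x \<le> 0" "x \<noteq> 0"
    by force
  then show "A_op e x =
      (if inner e x > 0 then {x - ((norm x)\<^sup>2 / inner e x) *\<^sub>R e}
       else if x = 0 then {t *\<^sub>R e |t::real. t \<le> 0}
       else {})"
  proof cases
    case pos
    then have "0 \<le> r \<and> (norm x)\<^sup>2 = r * inner e x \<longleftrightarrow> r = (norm x)\<^sup>2 / inner e x" for r
      by (metis divide_nonneg_pos eq_divide_eq less_irrefl zero_le_power2)
    with pos show ?thesis
      by (simp add: A)
  next
    case zero
    have "{- (r *\<^sub>R e) |r. 0 \<le> r} = {t *\<^sub>R e |t. t \<le> 0}"
      by (auto simp flip: scaleR_minus_left) (metis neg_0_le_iff_le minus_minus)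
    with zero show ?thesis
      by (simp add: A[unfolded zero])
  next
    case other
    have "(norm x)\<^sup>2 \<noteq> r * inner e x" if "0 \<le> r" for r
    proof -
      have "r * inner e x \<le> 0"
        using that other by (simp add: mult_nonneg_nonpos)
      also have "0 < (norm x)\<^sup>2"
        using other by simp
      finally show ?thesis
        by simp
    qed
    with other show ?thesis
      by (auto simp: A)
  qed
qed

end
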